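(* There does not exist a non-zero real constant $\alpha$ such that the sequence $\left\{\frac18,1,2,0,0,\ldots\right\}$ (that is, $\gamma_0=\frac18$, $\gamma_1=1$, $\gamma_2=2$, $\gamma_k=0$ for $k\ge 3$) is an $\mathcal{H}^{(\alpha)}$-multiplier sequence.
   Context: For real $\alpha\neq 0$, the generalized Hermite polynomials are $\mathcal{H}^{(\alpha)}_n(x)=(-\alpha)^n e^{x^2/(2\alpha)}\frac{d^n}{dx^n}e^{-x^2/(2\alpha)}=\sum_{k=0}^{\lfloor n/2\rfloor}\frac{n!}{k!\,(n-2k)!}\left(-\frac{\alpha}{2}\right)^k x^{n-2k}$, $n=0,1,2,\ldots$ (so $\mathcal{H}^{(\alpha)}_0=1$, $\mathcal{H}^{(\alpha)}_1=x$, $\mathcal{H}^{(\alpha)}_2=x^2-\alpha$). A polynomial "has only real zeros" if it has no non-real complex zeros or is identically zero (nonzero constants also qualify). A sequence of real numbers $\{\gamma_k\}_{k=0}^\infty$ is an $\mathcal{H}^{(\alpha)}$-multiplier sequence if, for every $n$ and all real $a_0,\ldots,a_n$, the polynomial $\sum_{k=0}^n a_k\gamma_k \mathcal{H}^{(\alpha)}_k(x)$ has only real zeros whenever $\sum_{k=0}^n a_k \mathcal{H}^{(\alpha)}_k(x)$ has only real zeros. *)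

theory Defs
  imports "HOL-Analysis.Analysis" "HOL-Computational_Algebra.Polynomial"
begin

definition gen_hermite :: "real \<Rightarrow> nat \<Rightarrow> real poly" where
  "gen_hermite \<alpha> n =
     (\<Sum>k\<le>n div 2. monom (fact n / (fact k * fact (n - 2 * k)) * (- \<alpha> / 2) ^ k) (n - 2 * k))"

definition only_real_zeros :: "real poly \<Rightarrow> bool" where
  "only_real_zeros p \<longleftrightarrow>
     p = 0 \<or> (\<forall>z::complex. poly (map_poly complex_of_real p) z = 0 \<longrightarrow> z \<in> \<real>)"

definition hermite_multiplier_seq :: "real \<Rightarrow> (nat \<Rightarrow> real) \<Rightarrow> bool" where
  "hermite_multiplier_seq \<alpha> \<gamma> \<longleftrightarrow>
     (\<forall>(n::nat) (a::nat \<Rightarrow> real).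
        only_real_zeros (\<Sum>k\<le>n. smult (a k) (gen_hermite \<alpha> k)) \<longrightarrow>
        only_real_zeros (\<Sum>k\<le>n. smult (a k * \<gamma> k) (gen_hermite \<alpha> k)))"

lemma coeff_gen_hermite:
  "coeff (gen_hermite \<alpha> n) j =
     (if j \<le> n \<and> even (n - j)
      then fact n / (fact ((n - j) div 2) * fact j) * (- \<alpha> / 2) ^ ((n - j) div 2) else 0)"
proof (cases "j \<le> n \<and> even (n - j)")
  case True
  define i where "i = (n - j) div 2"
  have n: "n = j + 2 * i" using True unfolding i_def by auto
  have "coeff (gen_hermite \<alpha> n) j =
      (\<Sum>k\<le>n div 2. if k = i
         then fact n / (fact k * fact (n - 2 * k)) * (- \<alpha> / 2) ^ k else 0)"
    unfolding gen_hermite_def coeff_sum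
    by (rule sum.cong) (auto simp: n)
  also have "\<dots> = fact n / (fact i * fact j) * (- \<alpha> / 2) ^ i"
    by (subst sum.delta) (auto simp: n)
  finally show ?thesis unfolding i_def if_P[OF True] .
next
  case False
  have "n - 2 * k \<noteq> j" if "k \<le> n div 2" for k
    using False that by auto
  then show ?thesis using False
    by (auto simp: gen_hermite_def coeff_sum intro!: sum.neutral)
qed

lemma gen_hermite_Suc:
  "gen_hermite \<alpha> (Suc n) =
     pCons 0 (gen_hermite \<alpha> n) - smult \<alpha> (pderiv (gen_hermite \<alpha> n))"
proof (rule poly_eqI)
  fix j
  define b where "b = - \<alpha> / 2"
  have \<alpha>: "\<alpha> = - 2 * b" by (simp add: b_def)
  show "coeff (gen_hermite \<alpha> (Suc n)) j =
    coeff (pCons 0 (gen_hermite \<alpha> n) - smult \<alpha> (pderiv (gen_hermite \<alpha> n))) j"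
  proof (cases "j \<le> Suc n \<and> even (Suc n - j)")
    case True
    define k where "k = (Suc n - j) div 2"
    have n: "Suc n = j + 2 * k" using True unfolding k_def by auto
    have F: "fact (Suc n) = (real j + 2 * real k) * fact n"
      using arg_cong[OF n, of real] by simp
    show ?thesis
    proof (cases j)
      case 0
      then obtain k' where k: "k = Suc k'" using n by (cases k) auto
      have n': "n = Suc (2 * k')" using n 0 k by simp
      have F0: "fact (Suc n) = 2 * real (Suc k') * fact n" using F 0 k by simp
      have d: "Suc n div 2 = Suc k'" "(n - 1) div 2 = k'" "even (Suc n)" "even (n - 1)" "1 \<le> n"
        by (auto simp: n')
      have X: "coeff (gen_hermite \<alpha> (Suc n)) 0 =
          2 * real (Suc k') * fact n / (fact (Suc k') * fact 0) * b ^ Suc k'"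
        unfolding coeff_gen_hermite F0 diff_zero d using d by (simp add: b_def del: fact_Suc)
      have Y: "coeff (gen_hermite \<alpha> n) (Suc 0) = fact n / (fact k' * fact 1) * b ^ k'"
        unfolding coeff_gen_hermite One_nat_def[symmetric] d using d
        by (simp add: b_def del: fact_Suc)
      have R: "2 * y * f / (y * g) * (b * c) = 2 * b * (f / g * c)" if "y > 0" for y f g c :: real
        using that by simp
      have fs: "fact (Suc k') = real (Suc k') * fact k'" by simp
      show ?thesis
        unfolding 0 coeff_diff coeff_pCons coeff_smult coeff_pderiv X Y nat.case fs power_Suc
          fact_0 fact_1 mult_1_right
        by (subst R) (simp_all add: \<alpha>)
    next
      case (Suc j')
      note j = this
      show ?thesis
      proof (cases k)
        case 0
        then have "n = j'" using n j by simp
        then show ?thesis using j by (simp add: coeff_gen_hermite coeff_pderiv)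
      next
        case (Suc k')
        have n': "n = Suc (j' + Suc (2 * k'))" using n j Suc by simp
        have d: "(n - j') div 2 = Suc k'" "(n - Suc (Suc j')) div 2 = k'"
          "(Suc n - Suc j') div 2 = Suc k'" "even (n - j')" "even (n - Suc (Suc j'))"
          "j' \<le> n" "Suc (Suc j') \<le> n"
          by (auto simp: n')
        have F': "fact (Suc n) = (real (Suc j') + 2 * real (Suc k')) * fact n"
          using F j Suc by simp
        have X: "coeff (gen_hermite \<alpha> (Suc n)) j =
            (real (Suc j') + 2 * real (Suc k')) * fact n / (fact (Suc k') * fact (Suc j')) * b ^ Suc k'"
          unfolding coeff_gen_hermite F' j d using d by (simp add: b_def del: fact_Suc)
        have Y: "coeff (gen_hermite \<alpha> n) j' = fact n / (fact (Suc k') * fact j') * b ^ Suc k'"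
          unfolding coeff_gen_hermite d using d by (simp add: b_def del: fact_Suc)
        have Z: "coeff (gen_hermite \<alpha> n) (Suc (Suc j')) =
            fact n / (fact k' * fact (Suc (Suc j'))) * b ^ k'"
          unfolding coeff_gen_hermite d using d by (simp add: b_def del: fact_Suc)
        have R: "(x + 2 * y) * f / ((y * g) * (x * h)) * (b * c) =
            f / ((y * g) * h) * (b * c) + 2 * b * ((x + 1) * (f / (g * ((x + 1) * (x * h))) * c))"
          if "x > 0" "y > 0" "g > 0" "h > 0" for x y f g h c :: real
        proof -
          have 1: "(x + 2 * y) * f / ((y * g) * (x * h)) = f / ((y * g) * h) + 2 * (f / (g * (x * h)))"
            using that by (simp add: field_simps)
          have 2: "f / (g * ((x + 1) * (x * h))) = (f / (g * (x * h))) / (x + 1)"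
            by (simp add: ac_simps)
          have 3: "(x + 1) * ((u / (x + 1)) * c) = u * c" for u
            using that by simp
          show ?thesis unfolding 1 2 3 by (simp add: algebra_simps)
        qed
        have fs: "fact (Suc k') = real (Suc k') * fact k'" "fact (Suc j') = real (Suc j') * fact j'"
          "fact (Suc (Suc j')) = (real (Suc j') + 1) * (real (Suc j') * fact j')"
          by (simp_all add: algebra_simps)
        show ?thesis
          unfolding j X[unfolded j] coeff_diff coeff_pCons coeff_smult coeff_pderiv nat.case Y Z
          unfolding fs power_Suc
          by (subst R) (simp_all add: \<alpha>)
      qed
    qed
  next
    case False
    then show ?thesis
      by (cases j) (auto simp: coeff_gen_hermite coeff_pderiv coeff_pCons)
  qed
qed

lemma gen_hermite_rodrigues:
  assumes "\<alpha> \<noteq> 0"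
  shows "poly (gen_hermite \<alpha> n) x =
    (- \<alpha>) ^ n * exp (x\<^sup>2 / (2 * \<alpha>)) * (deriv ^^ n) (\<lambda>t. exp (- t\<^sup>2 / (2 * \<alpha>))) x"
proof -
  have D: "(deriv ^^ n) (\<lambda>t. exp (- t\<^sup>2 / (2 * \<alpha>))) =
      (\<lambda>t. (- 1 / \<alpha>) ^ n * poly (gen_hermite \<alpha> n) t * exp (- t\<^sup>2 / (2 * \<alpha>)))"
  proof (induction n)
    case 0
    then show ?case by (simp add: gen_hermite_def)
  next
    case (Suc n)
    have A: "(c * q) * e + (e * (- t / \<alpha>)) * (c * p) =
        (- 1 / \<alpha> * c) * (0 + t * p - \<alpha> * q) * e" for c q e t p :: real
      using assms by (simp add: right_diff_distrib left_diff_distrib)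
    have E: "((\<lambda>t. exp (- t\<^sup>2 / (2 * \<alpha>))) has_field_derivative
        exp (- t\<^sup>2 / (2 * \<alpha>)) * (- t / \<alpha>)) (at t)" for t
      using assms by (auto intro!: derivative_eq_intros simp: field_simps)
    have "((\<lambda>t. (- 1 / \<alpha>) ^ n * poly (gen_hermite \<alpha> n) t * exp (- t\<^sup>2 / (2 * \<alpha>)))
        has_field_derivative
        (- 1 / \<alpha>) ^ Suc n * poly (gen_hermite \<alpha> (Suc n)) t * exp (- t\<^sup>2 / (2 * \<alpha>))) (at t)" for t
      by (rule DERIV_cong[OF DERIV_mult[OF DERIV_cmult[OF poly_DERIV] E]])
         (simp only: gen_hermite_Suc poly_diff poly_pCons poly_smult power_Suc A)
    then show ?case using Suc by (auto simp: DERIV_imp_deriv)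
  qed
  have 1: "(- \<alpha>) ^ n * (- 1 / \<alpha>) ^ n = 1"
    using assms by (simp flip: power_mult_distrib)
  have 2: "exp (x\<^sup>2 / (2 * \<alpha>)) * exp (- x\<^sup>2 / (2 * \<alpha>)) = 1"
    by (simp flip: exp_add)
  have 3: "a * e * (a' * p * e') = p" if "a * a' = 1" "e * e' = 1" for a a' e e' p :: real
  proof -
    have "a * e * (a' * p * e') = (a * a') * (e * e') * p" by (simp only: ac_simps)
    then show ?thesis using that by simp
  qed
  show ?thesis unfolding D 3[OF 1 2] ..
qed

end

theory Submission
  imports Defs
begin

text \<open>
  Applied to a polynomial with Hermite coefficients \<open>a\<^sub>k\<close> the sequence leaves the quadratic
  \<open>a\<^sub>0 / 8 + a\<^sub>1 x + 2 a\<^sub>2 (x\<^sup>2 - \<alpha>)\<close>, which has non-real zeros exactly when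
  \<open>a\<^sub>1\<^sup>2 + 16 \<alpha> a\<^sub>2\<^sup>2 < a\<^sub>0 a\<^sub>2\<close>. For each sign of \<open>\<alpha>\<close> some real-rooted even polynomial
  (so that \<open>a\<^sub>1 = 0\<close>) satisfies this inequality.

  If \<open>\<alpha> < 0\<close>, then \<open>x\<^sup>2 = H\<^sub>2 + \<alpha>\<close> works, since the inequality becomes \<open>16 \<alpha> < \<alpha>\<close>.

  If \<open>\<alpha> > 0\<close>, it suffices that \<open>0 < 16 \<alpha> a\<^sub>2 < a\<^sub>0\<close>: a small positive \<open>a\<^sub>2\<close> together with an
  \<open>a\<^sub>0\<close> that stays away from zero. For \<open>(x\<^sup>2 - s \<alpha>)\<^sup>2\<close> one has \<open>a\<^sub>2 = (6 - 2 s) \<alpha>\<close> and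
  \<open>a\<^sub>0 = (s\<^sup>2 - 2 s + 3) \<alpha>\<^sup>2\<close>. At \<open>s = 3\<close> these are \<open>0\<close> and \<open>6 \<alpha>\<^sup>2\<close>, so any \<open>s\<close> slightly below
  \<open>3\<close> works; the proof takes \<open>s = 29 / 10\<close>.
\<close>

lemma gen_hermite_0: "gen_hermite \<alpha> 0 = [:1:]"
  by (simp add: gen_hermite_def)

lemma gen_hermite_1: "gen_hermite \<alpha> (Suc 0) = [:0, 1:]"
  by (simp add: gen_hermite_Suc gen_hermite_0 pderiv_pCons)

lemma gen_hermite_2: "gen_hermite \<alpha> 2 = [:- \<alpha>, 0, 1:]"
  by (simp add: numeral_2_eq_2 gen_hermite_Suc[of _ "Suc 0"] gen_hermite_1 pderiv_pCons)

lemma gen_hermite_3: "gen_hermite \<alpha> 3 = [:0, - 3 * \<alpha>, 0, 1:]"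
  using gen_hermite_Suc[of \<alpha> 2] by (simp add: gen_hermite_2 pderiv_pCons)

lemma gen_hermite_4: "gen_hermite \<alpha> 4 = [:3 * \<alpha>\<^sup>2, 0, - 6 * \<alpha>, 0, 1:]"
  using gen_hermite_Suc[of \<alpha> 3] by (simp add: gen_hermite_3 pderiv_pCons power2_eq_square)

lemmas gen_hermite_0_to_4 =
  gen_hermite_0 gen_hermite_1 gen_hermite_2 gen_hermite_3 gen_hermite_4

lemma only_real_zeros_square_of_quadratic:
  assumes "c \<ge> 0"
  shows "only_real_zeros [:c\<^sup>2, 0, - 2 * c, 0, 1:]"
  unfolding only_real_zeros_def
proof (intro disjI2 allI impI)
  fix z :: complex
  define r where "r = complex_of_real (sqrt c)"
  have c: "complex_of_real c = r * r"
    using assms by (simp add: r_def flip: of_real_mult)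
  assume "poly (map_poly complex_of_real [:c\<^sup>2, 0, - 2 * c, 0, 1:]) z = 0"
  then have "((z - r) * (z + r))\<^sup>2 = 0"
    by (simp add: map_poly_pCons c power2_eq_square algebra_simps)
  then have "z = r \<or> z = - r"
    by (simp add: add_eq_0_iff2)
  then show "z \<in> \<real>"
    by (auto simp: r_def)
qed

lemma only_real_zeros_monom: "only_real_zeros (monom c n)"
  by (auto simp: only_real_zeros_def map_poly_monom poly_monom)

lemma not_only_real_zeros_positive_quadratic:
  assumes "c > 0" "d > 0"
  shows "\<not> only_real_zeros [:c, 0, d:]"
proof
  assume R: "only_real_zeros [:c, 0, d:]"
  define z where "z = \<i> * complex_of_real (sqrt (c / d))"
  have "complex_of_real (sqrt (c / d)) * complex_of_real (sqrt (c / d)) = complex_of_real (c / d)"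
    using assms by (simp flip: of_real_mult)
  then have "z * z = - complex_of_real (c / d)"
    by (simp add: z_def algebra_simps)
  then have "complex_of_real c + z * z * complex_of_real d = 0"
    using assms by simp
  then have "poly (map_poly complex_of_real [:c, 0, d:]) z = 0"
    by (simp add: map_poly_pCons algebra_simps)
  then have "z \<in> \<real>"
    using R assms by (auto simp: only_real_zeros_def)
  then show False
    using assms by (simp add: z_def complex_is_Real_iff)
qed

theorem proposition4:
  shows "\<not> (\<exists>\<alpha>::real. \<alpha> \<noteq> 0 \<and>
    hermite_multiplier_seq \<alpha>
      (\<lambda>k. if k = 0 then 1 / 8 else if k = 1 then 1 else if k = 2 then 2 else 0))"
proof (rule notI, elim exE conjE)
  fix \<alpha> :: real
  let ?\<gamma> = "\<lambda>k::nat. if k = 0 then 1 / 8 else if k = 1 then 1 else if k = 2 then 2 else 0 :: real"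
  assume "\<alpha> \<noteq> 0" and mult: "hermite_multiplier_seq \<alpha> ?\<gamma>"
  \<comment> \<open>It suffices to test even polynomials of degree at most \<open>4\<close>, for which \<open>a\<^sub>1 = a\<^sub>3 = 0\<close>.\<close>
  have even_quartic: "only_real_zeros [:a0 / 8 - 2 * a2 * \<alpha>, 0, 2 * a2:]"
    if "only_real_zeros [:a0 - a2 * \<alpha> + 3 * a4 * \<alpha>\<^sup>2, 0, a2 - 6 * a4 * \<alpha>, 0, a4:]" for a0 a2 a4
  proof -
    define a where "a = (\<lambda>k::nat. if k = 0 then a0 else if k = 2 then a2 else if k = 4 then a4 else 0)"
    have set: "{..4} = {0, 1, 2, 3, 4::nat}"
      by auto
    have "(\<Sum>k\<le>4. smult (a k) (gen_hermite \<alpha> k)) =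
        [:a0 - a2 * \<alpha> + 3 * a4 * \<alpha>\<^sup>2, 0, a2 - 6 * a4 * \<alpha>, 0, a4:]"
      unfolding set by (simp add: a_def gen_hermite_0_to_4)
    moreover have "(\<Sum>k\<le>4. smult (a k * ?\<gamma> k) (gen_hermite \<alpha> k)) =
        [:a0 / 8 - 2 * a2 * \<alpha>, 0, 2 * a2:]"
      unfolding set by (simp add: a_def gen_hermite_0_to_4)
    ultimately show ?thesis
      using mult[unfolded hermite_multiplier_seq_def, rule_format, of a 4] that
      by (simp only:)
  qed
  show False
  proof (cases "\<alpha> > 0")
    case True
    define c where "c = 29 / 10 * \<alpha>"
    have "only_real_zeros [:c\<^sup>2, 0, - 2 * c, 0, 1:]"
      using True by (intro only_real_zeros_square_of_quadratic) (simp add: c_def)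
    then have "only_real_zeros [:241 / 800 * \<alpha>\<^sup>2, 0, 2 / 5 * \<alpha>:]"
      using even_quartic[of "561 / 100 * \<alpha>\<^sup>2" "1 / 5 * \<alpha>" 1]
      by (simp add: c_def power2_eq_square algebra_simps)
    then show False
      using True by (simp add: not_only_real_zeros_positive_quadratic)
  next
    case False
    have "only_real_zeros [:0, 0, 1:]"
      using only_real_zeros_monom[of 1 2] by (simp add: monom_altdef power2_eq_square)
    then have "only_real_zeros [:- 15 / 8 * \<alpha>, 0, 2:]"
      using even_quartic[of \<alpha> 1 0] by simp
    then show False
      using False \<open>\<alpha> \<noteq> 0\<close> by (simp add: not_only_real_zeros_positive_quadratic)
  qed
qed

end
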